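(* Let $Q$ be a positive integer, let $x$ be the least common multiple of $1,2,\dots,Q$, and let $Y=(Y_{mn})_{m,n=1}^x$ be the $x\times x$ matrix with $Y_{mn}=\sum_{q=1}^Q S(m,n;q)$. Then the characteristic polynomial of $Y$ is \[ \det(\lambda E_x-Y)=\lambda^{x-\Phi(Q)}(\lambda-x)^{\frac{\Phi(Q)+\widetilde{\Phi}(Q)}{2}}(\lambda+x)^{\frac{\Phi(Q)-\widetilde{\Phi}(Q)}{2}}. \] In particular, $Y$ has eigenvalues $0,x,-x$ with multiplicities $x-\Phi(Q)$, $\frac{\Phi(Q)+\widetilde{\Phi}(Q)}{2}$, $\frac{\Phi(Q)-\widetilde{\Phi}(Q)}{2}$, respectively.
   Context: For positive integer $q$ and integers $m,n$, the Kloosterman sum is $S(m,n;q)=\sum_{1\le k\le q,\ \gcd(k,q)=1}\exp\bigl(\frac{2\pi i}{q}(mk+nk^* )\bigr)$, where $k^*$ denotes an inverse of $k$ modulo $q$. $\varphi$ is Euler's totient function and $\Phi(Q)=\sum_{q=1}^Q\varphi(q)$. Let $\widetilde{\varphi}(q)=\#\{1\le k\le q:\ \gcd(k,q)=1,\ k+k^*\equiv 0\pmod q\}$ and $\widetilde{\Phi}(Q)=\sum_{q=1}^Q\widetilde{\varphi}(q)$. $E_x$ is the $x\times x$ identity matrix. *)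

theory Defs
  imports
    Complex_Main
    "HOL-Number_Theory.Totient"
    "HOL-Number_Theory.Modular_Inverse"
    "Jordan_Normal_Form.Char_Poly"
begin

text \<open>
  Both summands below depend on the inverse of \<open>k\<close> only through its residue class modulo \<open>q\<close>,
  so the representative in \<open>{0..<q}\<close> chosen by \<^const>\<open>modular_inverse\<close> is as good as any other.
  This includes \<open>q = 1\<close>, where \<open>k = 1\<close> and the representative is \<open>0\<close>.
\<close>

definition kloosterman_sum :: "int \<Rightarrow> int \<Rightarrow> nat \<Rightarrow> complex" where
  "kloosterman_sum m n q =
     (\<Sum>k | k \<in> {1..int q} \<and> coprime k (int q).
        exp (2 * of_real pi * \<i> / of_nat q * of_int (m * k + n * modular_inverse (int q) k)))"

definition totient_tilde :: "nat \<Rightarrow> nat" where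
  "totient_tilde q =
     card {k \<in> {1..int q}. coprime k (int q) \<and> [k + modular_inverse (int q) k = 0] (mod int q)}"

definition totient_sum :: "nat \<Rightarrow> nat" where
  "totient_sum Q = (\<Sum>q = 1..Q. totient q)"

definition totient_tilde_sum :: "nat \<Rightarrow> nat" where
  "totient_tilde_sum Q = (\<Sum>q = 1..Q. totient_tilde q)"

text \<open>
  Matrix indices start at \<open>0\<close>, so the position \<open>(i, j)\<close> holds the entry of \<open>Y\<close> with
  \<open>m = i + 1\<close> and \<open>n = j + 1\<close>.
\<close>

definition kloosterman_matrix :: "nat \<Rightarrow> complex mat" where
  "kloosterman_matrix Q =
     (let x = Lcm {1..Q} in
        mat x x (\<lambda>(i, j). \<Sum>q = 1..Q. kloosterman_sum (int i + 1) (int j + 1) q))"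

end

theory Submission
  imports Defs "Jordan_Normal_Form.Schur_Decomposition"
begin

text \<open>
  Index the reduced fractions with denominator at most \<open>Q\<close> by pairs \<open>f = (q, k)\<close> and let \<open>u\<^sub>f\<close> and
  \<open>v\<^sub>f\<close> be the vectors with entries \<open>e(m k / q)\<close> and \<open>e(n k\<^sup>* / q)\<close>, where \<open>m\<close> and \<open>n\<close> run through
  \<open>{1..x}\<close>. Then \<open>Y\<close> is the sum of the rank-one matrices \<open>u\<^sub>f v\<^sub>f\<^sup>T\<close>, and \<open>v\<^sub>f\<^sup>T u\<^sub>g\<close> is \<open>x\<close> if \<open>g = \<tau> f\<close>
  and \<open>0\<close> otherwise, for the involution \<open>\<tau> (q, k) = (q, - k\<^sup>*)\<close>. Hence \<open>Y\<^sup>3 = x\<^sup>2 Y\<close>, the trace of \<open>Y\<^sup>2\<close>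
  is \<open>x\<^sup>2\<close> times the number of fractions, and the trace of \<open>Y\<close> is \<open>x\<close> times the number of fixed
  points of \<open>\<tau>\<close>. The eigenvalues therefore lie in \<open>{0, x, - x}\<close>, and the two traces determine their
  multiplicities.
\<close>

hide_const (open) Coset.order

section \<open>Traces and characteristic polynomials\<close>

definition mat_trace :: "'a :: comm_monoid_add mat \<Rightarrow> 'a" where
  "mat_trace A = (\<Sum>i<dim_row A. A $$ (i, i))"

lemma mat_trace_mult_commute:
  fixes A B :: "'a :: comm_semiring_0 mat"
  assumes "A \<in> carrier_mat n m" "B \<in> carrier_mat m n"
  shows "mat_trace (A * B) = mat_trace (B * A)"
proof -
  have "mat_trace (A * B) = (\<Sum>i<n. \<Sum>k<m. A $$ (i, k) * B $$ (k, i))"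
    using assms by (simp add: mat_trace_def scalar_prod_def lessThan_atLeast0)
  also have "\<dots> = (\<Sum>k<m. \<Sum>i<n. B $$ (k, i) * A $$ (i, k))"
    by (subst sum.swap) (simp add: mult.commute)
  also have "\<dots> = mat_trace (B * A)"
    using assms by (simp add: mat_trace_def scalar_prod_def lessThan_atLeast0)
  finally show ?thesis .
qed

lemma mat_trace_similar:
  fixes A B :: "'a :: comm_semiring_1 mat"
  assumes "similar_mat_wit A B P Q"
  shows "mat_trace A = mat_trace B"
proof -
  define n where "n = dim_row A"
  note w = similar_mat_witD[OF n_def assms]
  have "mat_trace A = mat_trace (P * (B * Q))"
    using w by (simp add: assoc_mult_mat)
  also have "\<dots> = mat_trace (B * Q * P)"
    using w by (intro mat_trace_mult_commute) auto
  also have "B * Q * P = B * (Q * P)"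
    using w by (simp add: assoc_mult_mat)
  also have "\<dots> = B"
    using w by simp
  finally show ?thesis .
qed

lemma upper_triangular_mult_diag:
  fixes A B :: "'a :: semiring_0 mat"
  assumes "A \<in> carrier_mat n n" "B \<in> carrier_mat n n"
    and "upper_triangular A" "upper_triangular B" "i < n"
  shows "(A * B) $$ (i, i) = A $$ (i, i) * B $$ (i, i)"
proof -
  have "(A * B) $$ (i, i) = (\<Sum>k\<in>{0..<n}. A $$ (i, k) * B $$ (k, i))"
    using assms by (simp add: scalar_prod_def)
  also have "\<dots> = (\<Sum>k\<in>{i}. A $$ (i, k) * B $$ (k, i))"
  proof (rule sum.mono_neutral_right)
    show "\<forall>k\<in>{0..<n} - {i}. A $$ (i, k) * B $$ (k, i) = 0"
    proof
      fix k assume k: "k \<in> {0..<n} - {i}"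
      then consider "k < i" | "i < k" by fastforce
      then show "A $$ (i, k) * B $$ (k, i) = 0"
        using assms k by cases (auto dest: upper_triangularD)
    qed
  qed (use assms in auto)
  finally show ?thesis by simp
qed

text \<open>Schur triangularisation puts the roots on the diagonal of \<open>B\<close>. The same
  \<open>P\<close> and \<open>Q\<close> carry \<open>A * A\<close> to \<open>B * B\<close>, whose
  diagonal entries are the squares of those of \<open>B\<close>.\<close>

lemma mat_trace_char_poly_roots:
  fixes A :: "'a :: conjugatable_ordered_field mat"
  assumes A: "A \<in> carrier_mat n n"
    and cp: "char_poly A = (\<Prod>e\<leftarrow>es. [:- e, 1:])"
  shows "mat_trace A = sum_list es"
    and "mat_trace (A * A) = (\<Sum>e\<leftarrow>es. e ^ 2)"
proof -
  obtain B P Q where "schur_decomposition A es = (B, P, Q)"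
    by (cases "schur_decomposition A es") auto
  from schur_decomposition[OF A cp this]
  have w: "similar_mat_wit A B P Q" and ut: "upper_triangular B" and d: "diag_mat B = es"
    by auto
  have B: "B \<in> carrier_mat n n"
    using similar_mat_witD2[OF A w] by auto
  have es: "es = map (\<lambda>i. B $$ (i, i)) [0..<n]"
    using B by (simp add: d[symmetric] diag_mat_def)
  show "mat_trace A = sum_list es"
    unfolding mat_trace_similar[OF w] using B by (simp add: es mat_trace_def
      interv_sum_list_conv_sum_set_nat lessThan_atLeast0)
  have "similar_mat_wit (A ^\<^sub>m 2) (B ^\<^sub>m 2) P Q"
    by (rule similar_mat_wit_pow[OF w])
  then have "similar_mat_wit (A * A) (B * B) P Q"
    using A B by (simp add: numeral_2_eq_2)
  from mat_trace_similar[OF this] have "mat_trace (A * A) = (\<Sum>i<n. B $$ (i, i) ^ 2)"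
    using B upper_triangular_mult_diag[OF B B ut ut]
    by (simp add: mat_trace_def power2_eq_square)
  then show "mat_trace (A * A) = (\<Sum>e\<leftarrow>es. e ^ 2)"
    by (simp add: es interv_sum_list_conv_sum_set_nat lessThan_atLeast0 comp_def)
qed

section \<open>Matrices whose cube is a multiple of the matrix\<close>

lemma cube_eq_imp_eigenvalue:
  fixes A :: "'a :: field mat"
  assumes A: "A \<in> carrier_mat n n" and cube: "A * A * A = c ^ 2 \<cdot>\<^sub>m A"
    and ev: "eigenvalue A \<mu>"
  shows "\<mu> \<in> {0, c, - c}"
proof -
  obtain v where v: "v \<in> carrier_vec n" "v \<noteq> 0\<^sub>v n" and e: "A *\<^sub>v v = \<mu> \<cdot>\<^sub>v v"
    using ev A unfolding eigenvalue_def eigenvector_def by auto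
  have "(A * A * A) *\<^sub>v v = A *\<^sub>v (A *\<^sub>v (A *\<^sub>v v))"
    using A v by (simp add: assoc_mult_mat_vec[of _ n n _ n])
  also have "\<dots> = \<mu> ^ 3 \<cdot>\<^sub>v v"
    using A v by (simp add: e mult_mat_vec[of _ n n] smult_smult_assoc power3_eq_cube)
  finally have "(A * A * A) *\<^sub>v v = \<mu> ^ 3 \<cdot>\<^sub>v v" .
  moreover have "(A * A * A) *\<^sub>v v = (c ^ 2 * \<mu>) \<cdot>\<^sub>v v"
  proof -
    have "(c ^ 2 \<cdot>\<^sub>m A) *\<^sub>v v = c ^ 2 \<cdot>\<^sub>v (A *\<^sub>v v)"
      using A v by (intro eq_vecI) (auto simp: row_smult)
    then show ?thesis by (simp add: cube e smult_smult_assoc)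
  qed
  ultimately have eq: "\<mu> ^ 3 \<cdot>\<^sub>v v = (c ^ 2 * \<mu>) \<cdot>\<^sub>v v" by simp
  \<comment> \<open>A nonzero coordinate turns the vector identity into a scalar one.\<close>
  obtain i where i: "i < n" "v $ i \<noteq> 0"
    using v by (metis carrier_vecD eq_vecI index_zero_vec)
  have "\<mu> ^ 3 * v $ i = c ^ 2 * \<mu> * v $ i"
    using arg_cong[OF eq, of "\<lambda>w. w $ i"] i v by simp
  then have "\<mu> ^ 3 = c ^ 2 * \<mu>" using i by simp
  then have "\<mu> * ((\<mu> - c) * (\<mu> + c)) = 0"
    by (simp add: algebra_simps power2_eq_square power3_eq_cube)
  then show ?thesis by (auto simp: eq_neg_iff_add_eq_0)
qed

text \<open>\<open>z\<close>, \<open>p\<close> and \<open>m\<close> count the entries assigned to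
  \<open>0\<close>, \<open>c\<close> and \<open>- c\<close>. Building them by induction also covers
  rings in which these values coincide.\<close>

lemma sum_list_three_values:
  fixes c :: "'a :: comm_ring_1"
  assumes "set es \<subseteq> {0, c, - c}"
  obtains z p m :: nat where
    "length es = z + p + m"
    "sum_list es = c * (of_nat p - of_nat m)"
    "(\<Sum>e\<leftarrow>es. e ^ 2) = c ^ 2 * of_nat (p + m)"
    "(\<Prod>e\<leftarrow>es. [:- e, 1:]) = [:0, 1:] ^ z * [:- c, 1:] ^ p * [:c, 1:] ^ m"
  using assms
proof (induction es arbitrary: thesis)
  case Nil
  show ?case by (rule Nil.prems(1)[of 0 0 0]) simp_all
next
  case (Cons e es)
  obtain z p m :: nat where IH:
    "length es = z + p + m"
    "sum_list es = c * (of_nat p - of_nat m)"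
    "(\<Sum>e\<leftarrow>es. e ^ 2) = c ^ 2 * of_nat (p + m)"
    "(\<Prod>e\<leftarrow>es. [:- e, 1:]) = [:0, 1:] ^ z * [:- c, 1:] ^ p * [:c, 1:] ^ m"
    using Cons.IH Cons.prems(2) by auto
  consider "e = 0" | "e = c" | "e = - c" using Cons.prems(2) by auto
  then show ?case
  proof cases
    case 1
    show ?thesis by (rule Cons.prems(1)[of "Suc z" p m]) (simp_all add: IH 1 mult_ac)
  next
    case 2
    show ?thesis by (rule Cons.prems(1)[of z "Suc p" m])
      (simp_all only: list.map sum_list.Cons prod_list.Cons list.size IH 2,
       simp_all add: algebra_simps)
  next
    case 3
    show ?thesis by (rule Cons.prems(1)[of z p "Suc m"])
      (simp_all only: list.map sum_list.Cons prod_list.Cons list.size IH 3,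
       simp_all add: algebra_simps)
  qed
qed

text \<open>The size and the two traces give \<open>z + p + m = n\<close>, \<open>p - m = s\<close>
  and \<open>p + m = t\<close> for the multiplicities. As these are natural numbers, the
  inequalities and the parity follow.\<close>

lemma char_poly_of_cube_eq:
  fixes A :: "complex mat" and s t :: nat
  assumes A: "A \<in> carrier_mat n n" and c: "c \<noteq> 0" and cube: "A * A * A = c ^ 2 \<cdot>\<^sub>m A"
    and tr: "mat_trace A = c * of_nat s" and tr2: "mat_trace (A * A) = c ^ 2 * of_nat t"
  shows "t \<le> n" "s \<le> t" "even (t + s)"
    "char_poly A = [:0, 1:] ^ (n - t) * [:- c, 1:] ^ ((t + s) div 2) * [:c, 1:] ^ ((t - s) div 2)"
proof -
  obtain es where cp: "char_poly A = (\<Prod>e\<leftarrow>es. [:- e, 1:])" and len: "length es = n"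
    using char_poly_factorized[OF A] by auto
  have "e \<in> {0, c, - c}" if "e \<in> set es" for e
  proof (rule cube_eq_imp_eigenvalue[OF A cube])
    show "eigenvalue A e"
      unfolding eigenvalue_root_char_poly[OF A] cp using that by (rule linear_poly_root)
  qed
  then have "set es \<subseteq> {0, c, - c}" by blast
  then obtain z p m :: nat where *:
    "length es = z + p + m"
    "sum_list es = c * (of_nat p - of_nat m)"
    "(\<Sum>e\<leftarrow>es. e ^ 2) = c ^ 2 * of_nat (p + m)"
    "(\<Prod>e\<leftarrow>es. [:- e, 1:]) = [:0, 1:] ^ z * [:- c, 1:] ^ p * [:c, 1:] ^ m"
    by (rule sum_list_three_values)
  \<comment> \<open>The form \<open>p = m + s\<close> avoids truncated subtraction when the equation
    is carried back to the naturals.\<close>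
  have "(of_nat p :: complex) = of_nat (m + s)"
  proof -
    have "c * of_nat s = c * (of_nat p - of_nat m)"
      using mat_trace_char_poly_roots(1)[OF A cp] tr *(2) by simp
    then have "(of_nat s :: complex) = of_nat p - of_nat m"
      using c by (simp only: mult_cancel_left) simp
    then show ?thesis by simp
  qed
  then have p: "p = m + s" by (simp only: of_nat_eq_iff)
  have "(of_nat t :: complex) = of_nat (p + m)"
    using mat_trace_char_poly_roots(2)[OF A cp] tr2 c *(3) by simp
  then have t: "t = p + m" by (simp only: of_nat_eq_iff)
  show "t \<le> n" "s \<le> t" "even (t + s)" using *(1) len p t by auto
  have "z = n - t" "p = (t + s) div 2" "m = (t - s) div 2"
    using *(1) len p t by auto
  then show "char_poly A = [:0, 1:] ^ (n - t) * [:- c, 1:] ^ ((t + s) div 2) * [:c, 1:] ^ ((t - s) div 2)"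
    using cp *(4) by simp
qed

lemma order_three_linear_powers:
  fixes c :: "'a :: field_char_0" and z p m :: nat
  assumes "c \<noteq> 0"
  defines "P \<equiv> [:0, 1:] ^ z * [:- c, 1:] ^ p * [:c, 1:] ^ m"
  shows "order 0 P = z" "order c P = p" "order (- c) P = m"
proof -
  have *: "order a P = order a ([:0, 1:] ^ z) + order a ([:- c, 1:] ^ p) + order a ([:c, 1:] ^ m)" for a
    unfolding P_def by (subst order_mult, simp, subst order_mult) auto
  \<comment> \<open>In characteristic zero the three roots are distinct, so each factor contributes
    to one order only.\<close>
  have "- c \<noteq> c" using assms by simp
  then show "order 0 P = z" "order c P = p" "order (- c) P = m"
    using order_power_n_n[of 0 z] order_power_n_n[of c p] order_power_n_n[of "- c" m] assms(1)
    by (auto simp: * order_0I)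
qed

section \<open>Sums of rank-one matrices permuted by an involution\<close>

text \<open>The pairings of the \<open>v f\<close> with the \<open>u g\<close> form \<open>c\<close>
  times the permutation matrix of \<open>\<tau>\<close>. Powers and traces of the matrix are
  computed from this relation.\<close>

locale dual_family =
  fixes F :: "'b set" and n :: nat and u v :: "'b \<Rightarrow> nat \<Rightarrow> 'a :: comm_ring_1"
    and \<tau> :: "'b \<Rightarrow> 'b" and c :: 'a
  assumes fin: "finite F"
    and closed: "f \<in> F \<Longrightarrow> \<tau> f \<in> F"
    and invol: "f \<in> F \<Longrightarrow> \<tau> (\<tau> f) = f"
    and dual: "\<lbrakk>f \<in> F; g \<in> F\<rbrakk> \<Longrightarrow> (\<Sum>i<n. v f i * u g i) = (if g = \<tau> f then c else 0)"
begin

text \<open>The twist \<open>h\<close> keeps products within one family: the square of the untwisted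
  sum is \<open>c\<close> times the sum twisted by \<open>\<tau>\<close>.\<close>

definition rank_one_sum :: "('b \<Rightarrow> 'b) \<Rightarrow> 'a mat" where
  "rank_one_sum h = mat n n (\<lambda>(i, j). \<Sum>f\<in>F. u f i * v (h f) j)"

lemma rank_one_sum_carrier [simp]: "rank_one_sum h \<in> carrier_mat n n"
  by (simp add: rank_one_sum_def)

text \<open>Pairing \<open>v (h f)\<close> with \<open>u g\<close> leaves only
  \<open>g = \<tau> (h f)\<close>, so multiplying by the untwisted sum composes
  \<open>\<tau>\<close> onto the twist.\<close>

lemma rank_one_sum_mult:
  assumes h: "\<And>f. f \<in> F \<Longrightarrow> h f \<in> F"
  shows "rank_one_sum h * rank_one_sum (\<lambda>f. f) = c \<cdot>\<^sub>m rank_one_sum (\<lambda>f. \<tau> (h f))"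
proof (rule eq_matI)
  fix i j assume ij: "i < dim_row (c \<cdot>\<^sub>m rank_one_sum (\<lambda>f. \<tau> (h f)))"
    "j < dim_col (c \<cdot>\<^sub>m rank_one_sum (\<lambda>f. \<tau> (h f)))"
  then have "i < n" "j < n" by (simp_all add: rank_one_sum_def)
  then have "(rank_one_sum h * rank_one_sum (\<lambda>f. f)) $$ (i, j) =
      (\<Sum>k<n. (\<Sum>f\<in>F. u f i * v (h f) k) * (\<Sum>g\<in>F. u g k * v g j))"
    by (simp add: rank_one_sum_def scalar_prod_def lessThan_atLeast0)
  also have "\<dots> = (\<Sum>f\<in>F. \<Sum>g\<in>F. u f i * v g j * (\<Sum>k<n. v (h f) k * u g k))"
    unfolding sum_product
    unfolding sum_distrib_left
    by (subst sum.swap, rule sum.cong[OF refl], subst sum.swap, intro sum.cong refl) (simp add: mult_ac)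
  also have "\<dots> = (\<Sum>f\<in>F. \<Sum>g\<in>F. if g = \<tau> (h f) then u f i * v g j * c else 0)"
    by (intro sum.cong refl) (simp add: dual h)
  also have "\<dots> = (\<Sum>f\<in>F. u f i * v (\<tau> (h f)) j * c)"
    by (intro sum.cong refl) (simp add: fin closed h)
  also have "\<dots> = (c \<cdot>\<^sub>m rank_one_sum (\<lambda>f. \<tau> (h f))) $$ (i, j)"
    using \<open>i < n\<close> \<open>j < n\<close> by (simp add: rank_one_sum_def sum_distrib_left mult_ac)
  finally show "(rank_one_sum h * rank_one_sum (\<lambda>f. f)) $$ (i, j) =
    (c \<cdot>\<^sub>m rank_one_sum (\<lambda>f. \<tau> (h f))) $$ (i, j)" .
qed (simp_all add: rank_one_sum_def)

text \<open>The trace of a rank-one matrix is the pairing of its two vectors. With \<open>h\<close>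
  the identity this counts the fixed points of \<open>\<tau>\<close>; with \<open>h = \<tau>\<close>
  it counts all of \<open>F\<close>.\<close>

lemma mat_trace_rank_one_sum:
  assumes h: "\<And>f. f \<in> F \<Longrightarrow> h f \<in> F"
  shows "mat_trace (rank_one_sum h) = c * of_nat (card {f \<in> F. \<tau> (h f) = f})"
proof -
  have "mat_trace (rank_one_sum h) = (\<Sum>f\<in>F. \<Sum>i<n. v (h f) i * u f i)"
    by (subst sum.swap) (simp add: mat_trace_def rank_one_sum_def mult.commute)
  also have "\<dots> = (\<Sum>f\<in>F. if \<tau> (h f) = f then c else 0)"
    by (intro sum.cong refl) (auto simp: dual h)
  also have "\<dots> = c * of_nat (card {f \<in> F. \<tau> (h f) = f})"
    using fin by (simp add: sum.If_cases Int_def mult.commute)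
  finally show ?thesis .
qed

lemma rank_one_sum_cong:
  "(\<And>f. f \<in> F \<Longrightarrow> h f = h' f) \<Longrightarrow> rank_one_sum h = rank_one_sum h'"
  by (auto simp: rank_one_sum_def intro!: cong_mat sum.cong)

lemma rank_one_sum_square:
  "rank_one_sum (\<lambda>f. f) * rank_one_sum (\<lambda>f. f) = c \<cdot>\<^sub>m rank_one_sum \<tau>"
  by (simp add: rank_one_sum_mult)

lemma rank_one_sum_cube:
  "rank_one_sum (\<lambda>f. f) * rank_one_sum (\<lambda>f. f) * rank_one_sum (\<lambda>f. f) =
     c ^ 2 \<cdot>\<^sub>m rank_one_sum (\<lambda>f. f)"
proof -
  \<comment> \<open>Two twists by \<open>\<tau>\<close> cancel. This is known on \<open>F\<close>
    only, hence the congruence rule.\<close>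
  have "rank_one_sum \<tau> * rank_one_sum (\<lambda>f. f) = c \<cdot>\<^sub>m rank_one_sum (\<lambda>f. f)"
    by (simp add: rank_one_sum_mult closed invol cong: rank_one_sum_cong)
  then show ?thesis
    by (simp add: rank_one_sum_square mult_smult_assoc_mat[of _ n n _ n])
      (auto simp: power2_eq_square mult.assoc)
qed

lemma mat_trace_rank_one_sum_square:
  "mat_trace (rank_one_sum (\<lambda>f. f) * rank_one_sum (\<lambda>f. f)) = c ^ 2 * of_nat (card F)"
proof -
  have "mat_trace (c \<cdot>\<^sub>m rank_one_sum \<tau>) = c * mat_trace (rank_one_sum \<tau>)"
    by (simp add: mat_trace_def rank_one_sum_def sum_distrib_left)
  moreover have "{f \<in> F. \<tau> (\<tau> f) = f} = F" using invol by auto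
  ultimately show ?thesis
    by (simp add: rank_one_sum_square mat_trace_rank_one_sum closed power2_eq_square mult.assoc)
qed

end

section \<open>Kloosterman sums\<close>

lemma exp_2pi_i_quotient_eq_1_iff:
  assumes "b > 0"
  shows "exp (2 * of_real pi * \<i> * of_int a / of_nat b) = 1 \<longleftrightarrow> int b dvd a"
proof -
  have "exp (2 * of_real pi * \<i> * of_int a / of_nat b) = cis (2 * pi * of_int a / real b)"
    by (simp add: cis_conv_exp mult_ac)
  \<comment> \<open>A cosine of 1 forces the sine to vanish, so the real part decides.\<close>
  also have "\<dots> = 1 \<longleftrightarrow> cos (2 * pi * of_int a / real b) = 1"
    using cos_one_sin_zero by (auto simp: complex_eq_iff)
  also have "\<dots> \<longleftrightarrow> (\<exists>k :: int. 2 * pi * of_int a / real b = of_int k * 2 * pi)"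
    by (rule cos_one_2pi_int)
  also have "\<dots> \<longleftrightarrow> (\<exists>k :: int. real_of_int a = of_int (int b * k))"
    using assms by (simp add: field_simps)
  also have "\<dots> \<longleftrightarrow> int b dvd a"
    unfolding of_int_eq_iff dvd_def ..
  finally show ?thesis .
qed

text \<open>Exponents start at 1 because the matrix position \<open>i\<close> stands for the index
  \<open>i + 1\<close>. For \<open>z \<noteq> 1\<close> the extra factor \<open>z\<close> multiplies
  a vanishing geometric sum.\<close>

lemma sum_powers_root_of_unity:
  fixes z :: "'a :: field"
  assumes "z ^ n = 1"
  shows "(\<Sum>i<n. z ^ Suc i) = (if z = 1 then of_nat n else 0)"
proof (cases "z = 1")
  case False
  have "(\<Sum>i<n. z ^ Suc i) = z * (\<Sum>i<n. z ^ i)"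
    by (simp add: sum_distrib_left)
  also have "(\<Sum>i<n. z ^ i) = 0"
    using False assms by (simp add: geometric_sum)
  finally show ?thesis using False by simp
qed simp

section \<open>Reduced fractions, their involution and their characters\<close>

definition farey_index :: "nat \<Rightarrow> (nat \<times> int) set" where
  "farey_index Q = (SIGMA q:{1..Q}. {k \<in> {1..int q}. coprime k (int q)})"

text \<open>The second component represents \<open>- k\<^sup>*\<close> in \<open>{1..q}\<close>.\<close>

definition neg_inverse :: "nat \<times> int \<Rightarrow> nat \<times> int" where
  "neg_inverse = (\<lambda>(q, k). (q, int q - modular_inverse (int q) k))"

text \<open>Written as a power so that a product of two characters becomes a power of a single root
  of unity.\<close>

definition additive_char :: "nat \<Rightarrow> int \<Rightarrow> nat \<Rightarrow> complex" where
  "additive_char q k i = exp (2 * of_real pi * \<i> * of_int k / of_nat q) ^ Suc i"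

lemma finite_int_interval_Collect [simp]: "finite {k. a \<le> k \<and> k \<le> b \<and> P (k :: int)}"
  by (rule finite_subset[of _ "{a..b}"]) auto

lemma finite_farey_index: "finite (farey_index Q)"
  by (simp add: farey_index_def)

lemma card_farey_index: "card (farey_index Q) = totient_sum Q"
proof -
  have "card {k \<in> {1..int q}. coprime k (int q)} = totient q" for q
  proof -
    have "{k \<in> {1..int q}. coprime k (int q)} = int ` totatives q"
    proof safe
      fix k assume "k \<in> {1..int q}" "coprime k (int q)"
      then have "nat k \<in> totatives q" "k = int (nat k)"
        by (auto simp: in_totatives_iff simp flip: coprime_int_iff)
      then show "k \<in> int ` totatives q" by blast
    qed (auto simp: in_totatives_iff coprime_int_iff)
    then show ?thesis by (simp add: card_image totient_def)
  qed
  then show ?thesis by (simp add: farey_index_def totient_sum_def)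
qed

lemma modular_inverse_bounds:
  assumes "q > 0"
  shows "0 \<le> modular_inverse (int q) k" "modular_inverse (int q) k < int q"
  using assms by (simp_all add: modular_inverse_int_nonneg modular_inverse_int_less)

lemma neg_inverse_in_farey_index:
  assumes "f \<in> farey_index Q"
  shows "neg_inverse f \<in> farey_index Q"
proof -
  obtain q k where f: "f = (q, k)" by (cases f)
  with assms have q: "q \<in> {1..Q}" and k: "coprime k (int q)" by (auto simp: farey_index_def)
  have "coprime (modular_inverse (int q) k) (int q)" using k by simp
  then have "coprime (int q - modular_inverse (int q) k) (int q)"
    by (simp add: coprime_iff_gcd_eq_1 gcd_diff2)
  \<comment> \<open>The inverse lies in \<open>{0..<q}\<close>, so its difference from
    \<open>q\<close> lies in \<open>{1..q}\<close>; for \<open>q = 1\<close> the inverse is 0 and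
    the difference is 1.\<close>
  moreover have "int q - modular_inverse (int q) k \<in> {1..int q}"
    using q modular_inverse_bounds[of q k] by simp
  ultimately show ?thesis
    using q unfolding f farey_index_def neg_inverse_def by simp
qed

lemma neg_inverse_neg_inverse:
  assumes "f \<in> farey_index Q"
  shows "neg_inverse (neg_inverse f) = f"
proof -
  obtain q k where f: "f = (q, k)" by (cases f)
  with assms have k: "k \<in> {1..int q}" "coprime k (int q)" by (auto simp: farey_index_def)
  \<comment> \<open>Modulo \<open>q\<close>, the inverse of \<open>- k\<^sup>*\<close> is
    \<open>- k\<close>, and its representative in \<open>{0..<q}\<close> is \<open>q - k\<close>
    since \<open>k\<close> lies in \<open>{1..q}\<close>.\<close>
  have "modular_inverse (int q) (int q - modular_inverse (int q) k) = int q - k"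
  proof (rule modular_inverse_int_eqI)
    have "(int q - modular_inverse (int q) k) * (int q - k) =
        int q * (int q - k - modular_inverse (int q) k) + k * modular_inverse (int q) k"
      by (simp add: algebra_simps)
    then have "[(int q - modular_inverse (int q) k) * (int q - k) = k * modular_inverse (int q) k] (mod int q)"
      by (simp add: cong_def)
    then show "[(int q - modular_inverse (int q) k) * (int q - k) = 1] (mod int q)"
      using cong_modular_inverse1[OF k(2)] cong_trans by blast
  qed (use k in auto)
  then show ?thesis by (simp add: f neg_inverse_def)
qed

text \<open>The ranges of inverses and of numerators are open at opposite ends, so
  \<open>a + b\<close> lies strictly between 0 and \<open>2 * q\<close>, where \<open>q\<close> is
  the only multiple of \<open>q\<close>.\<close>

lemma dvd_sum_iff_eq_diff:
  fixes a b q :: int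
  assumes "0 \<le> a" "a < q" "1 \<le> b" "b \<le> q"
  shows "q dvd a + b \<longleftrightarrow> b = q - a"
proof
  assume "q dvd a + b"
  then obtain m where m: "a + b = q * m" ..
  have "0 < q * m" "q * m < q * 2" unfolding m[symmetric] using assms by auto
  moreover have "q > 0" using assms by simp
  ultimately have "0 < m" "m < 2"
    by (simp_all only: zero_less_mult_iff mult_less_cancel_left_pos) auto
  then show "b = q - a" using m by (cases "m = 1") auto
qed simp

lemma card_fixed_neg_inverse:
  "card {f \<in> farey_index Q. neg_inverse f = f} = totient_tilde_sum Q"
proof -
  have "{f \<in> farey_index Q. neg_inverse f = f} =
    (SIGMA q:{1..Q}. {k \<in> {1..int q}. coprime k (int q) \<and> [k + modular_inverse (int q) k = 0] (mod int q)})"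
  proof -
    have "int q - modular_inverse (int q) k = k \<longleftrightarrow> [k + modular_inverse (int q) k = 0] (mod int q)"
      if "q > 0" "k \<in> {1..int q}" for q k
      using dvd_sum_iff_eq_diff[of "modular_inverse (int q) k" "int q" k] modular_inverse_bounds[of q k] that
      by (auto simp: cong_0_iff add.commute)
    then show ?thesis
      by (auto simp: farey_index_def neg_inverse_def)
  qed
  then show ?thesis by (simp add: totient_tilde_sum_def totient_tilde_def)
qed

text \<open>Two reduced fractions can only add up to an integer if their denominators agree.\<close>

lemma additive_char_orthogonal:
  assumes f: "(q, k) \<in> farey_index Q" and g: "(r, l) \<in> farey_index Q"
    and x: "q dvd x" "r dvd x"
  shows "(\<Sum>i<x. additive_char q (modular_inverse (int q) k) i * additive_char r l i) =
    (if (r, l) = neg_inverse (q, k) then of_nat x else 0)"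
proof -
  define k' where "k' = modular_inverse (int q) k"
  \<comment> \<open>The ratio of the geometric progression to be summed, over the common denominator
    \<open>q * r\<close> so that \<open>z = 1\<close> becomes a divisibility.\<close>
  define z where "z = exp (2 * of_real pi * \<i> * of_int (k' * int r + l * int q) / of_nat (q * r))"
  have q: "q > 0" "coprime k (int q)" and r: "r > 0" "l \<in> {1..int r}" "coprime l (int r)"
    using f g by (auto simp: farey_index_def)
  have k': "coprime k' (int q)" "0 \<le> k'" "k' < int q"
    using q modular_inverse_bounds[of q k] by (simp_all add: k'_def)
  have z: "z = exp (2 * of_real pi * \<i> * of_int k' / of_nat q) * exp (2 * of_real pi * \<i> * of_int l / of_nat r)"
    unfolding z_def exp_add[symmetric] using q r by (simp add: field_simps)
  \<comment> \<open>Both factors of \<open>z\<close> are roots of unity whose order divides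
    \<open>x\<close>, so the sum runs over full periods.\<close>
  have *: "exp (2 * of_real pi * \<i> * of_int a / of_nat b) ^ x = 1" if "b > 0" "b dvd x" for a :: int and b
  proof -
    obtain d where "x = b * d" using \<open>b dvd x\<close> ..
    have "exp (2 * of_real pi * \<i> * of_int a / of_nat b) ^ b = 1"
      unfolding exp_of_nat_mult[symmetric]
      using exp_2pi_i_quotient_eq_1_iff[of 1 a] that by simp
    then show ?thesis by (simp add: \<open>x = b * d\<close> power_mult)
  qed
  have zx: "z ^ x = 1"
    using * q r x by (simp add: z power_mult_distrib)
  have "z = 1 \<longleftrightarrow> int (q * r) dvd k' * int r + l * int q"
    unfolding z_def using q r by (intro exp_2pi_i_quotient_eq_1_iff) simp
  also have "\<dots> \<longleftrightarrow> (r, l) = neg_inverse (q, k)"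
  proof
    assume d: "int (q * r) dvd k' * int r + l * int q"
    have "int q dvd k' * int r + l * int q" "int r dvd k' * int r + l * int q"
      using dvd_trans[OF _ d, of "int q"] dvd_trans[OF _ d, of "int r"] by simp_all
    then have "int q dvd k' * int r" "int r dvd l * int q"
      by simp_all
    \<comment> \<open>\<open>k'\<close> is coprime to \<open>q\<close> and \<open>l\<close> to
      \<open>r\<close>, so each denominator divides the other.\<close>
    then have "int q dvd int r" "int r dvd int q"
      using k'(1) r(3) by (simp_all add: coprime_dvd_mult_right_iff coprime_commute)
    then have "r = q" by (simp add: dvd_antisym)
    with d have "int q * int q dvd int q * (k' + l)" by (simp add: algebra_simps)
    then have "int q dvd k' + l" using q by simp
    then have "l = int q - k'"
      using dvd_sum_iff_eq_diff[of k' "int q" l] k' r \<open>r = q\<close> by simp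
    then show "(r, l) = neg_inverse (q, k)"
      by (simp add: neg_inverse_def k'_def \<open>r = q\<close>)
  next
    assume "(r, l) = neg_inverse (q, k)"
    then have "r = q" "l = int q - k'"
      by (simp_all add: neg_inverse_def k'_def)
    then have "k' * int r + l * int q = int (q * r)"
      by (simp only: left_diff_distrib of_nat_mult)
    then show "int (q * r) dvd k' * int r + l * int q" by simp
  qed
  finally have "z = 1 \<longleftrightarrow> (r, l) = neg_inverse (q, k)" .
  moreover have "(\<Sum>i<x. additive_char q k' i * additive_char r l i) = (\<Sum>i<x. z ^ Suc i)"
    unfolding additive_char_def z power_mult_distrib ..
  ultimately show ?thesis
    using sum_powers_root_of_unity[OF zx] by (simp add: k'_def)
qed

text \<open>Each summand splits into a factor depending on \<open>i\<close> and one depending on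
  \<open>j\<close>, that is, into an entry of a rank-one matrix.\<close>

lemma kloosterman_sum_additive_char:
  "kloosterman_sum (int i + 1) (int j + 1) q =
     (\<Sum>k | k \<in> {1..int q} \<and> coprime k (int q).
        additive_char q k i * additive_char q (modular_inverse (int q) k) j)"
  unfolding kloosterman_sum_def additive_char_def exp_of_nat_mult[symmetric] exp_add[symmetric]
  by (intro sum.cong refl arg_cong[where f = exp]) (simp add: algebra_simps add_divide_distrib)

text \<open>The two inequalities and the parity make the natural-number subtractions and halvings in
  the exponents exact. Multiplicities are algebraic, expressed by \<open>order\<close>.\<close>

theorem theorem4:
  fixes Q x :: nat and Y :: "complex mat"
  assumes "Q > 0"
  defines "x \<equiv> Lcm {1..Q}"
    and "Y \<equiv> kloosterman_matrix Q"
  shows "totient_sum Q \<le> x \<and>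
         totient_tilde_sum Q \<le> totient_sum Q \<and>
         even (totient_sum Q + totient_tilde_sum Q) \<and>
         char_poly Y =
           [:0, 1:] ^ (x - totient_sum Q)
         * [:- of_nat x, 1:] ^ ((totient_sum Q + totient_tilde_sum Q) div 2)
         * [:of_nat x, 1:] ^ ((totient_sum Q - totient_tilde_sum Q) div 2) \<and>
         (\<forall>\<mu>. eigenvalue Y \<mu> \<longrightarrow> \<mu> \<in> {0, of_nat x, - of_nat x}) \<and>
         order 0 (char_poly Y) = x - totient_sum Q \<and>
         order (of_nat x) (char_poly Y) = (totient_sum Q + totient_tilde_sum Q) div 2 \<and>
         order (- of_nat x) (char_poly Y) = (totient_sum Q - totient_tilde_sum Q) div 2"
proof -
  define u :: "nat \<times> int \<Rightarrow> nat \<Rightarrow> complex" where "u = (\<lambda>(q, k). additive_char q k)"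
  define v :: "nat \<times> int \<Rightarrow> nat \<Rightarrow> complex"
    where "v = (\<lambda>(q, k). additive_char q (modular_inverse (int q) k))"
  have x: "q dvd x" if "q \<in> {1..Q}" for q
    using that by (simp add: x_def)
  interpret dual_family "farey_index Q" x u v neg_inverse "of_nat x"
  proof
    fix f g assume fg: "f \<in> farey_index Q" "g \<in> farey_index Q"
    obtain q k r l where "f = (q, k)" "g = (r, l)" by (cases f, cases g)
    with fg show "(\<Sum>i<x. v f i * u g i) = (if g = neg_inverse f then of_nat x else 0)"
      using additive_char_orthogonal[of q k Q r l x] x by (auto simp: u_def v_def farey_index_def)
  qed (simp_all add: finite_farey_index neg_inverse_in_farey_index neg_inverse_neg_inverse)
  \<comment> \<open>The sums over \<open>q\<close> and over \<open>k\<close> merge into one sum over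
    the pairs in \<open>farey_index Q\<close>.\<close>
  have Y: "Y = rank_one_sum (\<lambda>f. f)"
    unfolding Y_def kloosterman_matrix_def Let_def x_def[symmetric] rank_one_sum_def
    by (intro cong_mat refl)
       (simp add: kloosterman_sum_additive_char farey_index_def sum.Sigma u_def v_def case_prod_unfold)
  have x0: "(of_nat x :: complex) \<noteq> 0"
    by (simp add: x_def Lcm_0_iff)
  have carrier: "Y \<in> carrier_mat x x" and cube: "Y * Y * Y = of_nat x ^ 2 \<cdot>\<^sub>m Y"
    by (simp_all add: Y rank_one_sum_cube)
  have tr: "mat_trace Y = of_nat x * of_nat (totient_tilde_sum Q)"
    by (simp add: Y mat_trace_rank_one_sum card_fixed_neg_inverse)
  have tr2: "mat_trace (Y * Y) = of_nat x ^ 2 * of_nat (totient_sum Q)"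
    by (simp add: Y mat_trace_rank_one_sum_square card_farey_index)
  note cp = char_poly_of_cube_eq[OF carrier x0 cube tr tr2]
  show ?thesis
    using cp(1-3) cube_eq_imp_eigenvalue[OF carrier cube]
    unfolding cp(4) by (simp add: order_three_linear_powers[OF x0])
qed

end
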